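(* (1) Let $\phi:A\to B$ be an isomorphism of two nontrivial abelian subgroups $A$ and $B$ of a group $G$. If neither $A$ nor $B$ is maximal abelian in $G$, then the associated HNN-extension $G^\ast=\langle G,t\mid t^{-1}at=\phi(a),\ a\in A\rangle$ is not a CSA-group. (2) Let $\phi:A\to B$ be an isomorphism of two nontrivial abelian subgroups $A\le G$ and $B\le H$ of two groups $G$ and $H$. If $A$ is not maximal abelian in $G$ and $B$ is not maximal abelian in $H$, then the associated amalgamated product $G\ast_\phi H$ is not a CSA-group.
   Context: A subgroup $K$ of a group $G$ is malnormal if $K\cap x^{-1}Kx=1$ for all $x\in G\setminus K$. A group is a CSA-group if all its maximal abelian subgroups are malnormal. $G\ast_\phi H$ denotes the free product of $G$ and $H$ with $a$ identified with $\phi(a)$ for all $a\in A$. *)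

theory Defs
  imports "HOL-Algebra.Coset"
begin

definition malnormal :: "'a set \<Rightarrow> ('a, 'm) monoid_scheme \<Rightarrow> bool" where
  "malnormal K G \<longleftrightarrow>
     (\<forall>x \<in> carrier G - K. K \<inter> ((inv\<^bsub>G\<^esub> x <#\<^bsub>G\<^esub> K) #>\<^bsub>G\<^esub> x) = {\<one>\<^bsub>G\<^esub>})"

definition abelian_subgroup :: "'a set \<Rightarrow> ('a, 'm) monoid_scheme \<Rightarrow> bool" where
  "abelian_subgroup K G \<longleftrightarrow> subgroup K G \<and> comm_group (G\<lparr>carrier := K\<rparr>)"

definition maximal_abelian :: "'a set \<Rightarrow> ('a, 'm) monoid_scheme \<Rightarrow> bool" where
  "maximal_abelian K G \<longleftrightarrow>
     abelian_subgroup K G \<and> (\<forall>L. abelian_subgroup L G \<and> K \<subseteq> L \<longrightarrow> L = K)"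

text \<open>
  Being a group is deliberately not a conjunct here, so that the negation of this predicate
  always exhibits a maximal abelian subgroup that is not malnormal.
\<close>

definition CSA :: "('a, 'm) monoid_scheme \<Rightarrow> bool" where
  "CSA G \<longleftrightarrow> (\<forall>K. maximal_abelian K G \<longrightarrow> malnormal K G)"

datatype 'x letter = Gen 'x | Inv 'x

definition words :: "'x set \<Rightarrow> 'x letter list set" where
  "words S = lists (Gen ` S \<union> Inv ` S)"

text \<open>A pair \<open>(u, v)\<close> in \<open>R\<close> stands for the relation \<open>u = v\<close>.\<close>

inductive_set word_cong ::
  "'x set \<Rightarrow> ('x letter list \<times> 'x letter list) set \<Rightarrow> ('x letter list \<times> 'x letter list) set"
  for S R where
  refl: "w \<in> words S \<Longrightarrow> (w, w) \<in> word_cong S R"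
| sym: "(u, v) \<in> word_cong S R \<Longrightarrow> (v, u) \<in> word_cong S R"
| trans: "(u, v) \<in> word_cong S R \<Longrightarrow> (v, w) \<in> word_cong S R \<Longrightarrow> (u, w) \<in> word_cong S R"
| append: "(u, u') \<in> word_cong S R \<Longrightarrow> (v, v') \<in> word_cong S R \<Longrightarrow>
    (u @ v, u' @ v') \<in> word_cong S R"
| Gen_Inv: "x \<in> S \<Longrightarrow> ([Gen x, Inv x], []) \<in> word_cong S R"
| Inv_Gen: "x \<in> S \<Longrightarrow> ([Inv x, Gen x], []) \<in> word_cong S R"
| relation: "(u, v) \<in> R \<Longrightarrow> u \<in> words S \<Longrightarrow> v \<in> words S \<Longrightarrow> (u, v) \<in> word_cong S R"

definition presented_group ::
  "'x set \<Rightarrow> ('x letter list \<times> 'x letter list) set \<Rightarrow> 'x letter list set monoid" where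
  "presented_group S R =
     \<lparr>carrier = words S // word_cong S R,
      monoid.mult = (\<lambda>P Q. \<Union>p\<in>P. \<Union>q\<in>Q. word_cong S R `` {p @ q}),
      one = word_cong S R `` {[]}\<rparr>"

lemma words_Nil [simp]: "[] \<in> words S"
  by (simp add: words_def)

lemma words_append [simp]: "u @ v \<in> words S \<longleftrightarrow> u \<in> words S \<and> v \<in> words S"
  by (simp add: words_def)

lemma word_cong_words:
  assumes "(u, v) \<in> word_cong S R"
  shows "u \<in> words S \<and> v \<in> words S"
  using assms by induction (auto simp: words_def)

lemma equiv_word_cong: "equiv (words S) (word_cong S R)"
proof (rule equivI)
  show "word_cong S R \<subseteq> words S \<times> words S"
    using word_cong_words by fastforce
  show "refl_on (words S) (word_cong S R)"
    by (auto intro!: refl_onI word_cong.refl dest: word_cong_words)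
  show "Relation.sym (word_cong S R)"
    by (auto intro: symI word_cong.sym)
  show "Relation.trans (word_cong S R)"
    by (auto intro: transI word_cong.trans)
qed

lemma word_class_eq:
  "(u, v) \<in> word_cong S R \<Longrightarrow> word_cong S R `` {u} = word_cong S R `` {v}"
  using equiv_word_cong by (rule equiv_class_eq)

lemma mult_word_class:
  assumes "u \<in> words S" "v \<in> words S"
  shows "word_cong S R `` {u} \<otimes>\<^bsub>presented_group S R\<^esub> word_cong S R `` {v} =
         word_cong S R `` {u @ v}"
proof -
  have "(\<Union>p\<in>word_cong S R `` {u}. \<Union>q\<in>word_cong S R `` {v}. word_cong S R `` {p @ q}) =
        (\<Union>p\<in>word_cong S R `` {u}. \<Union>q\<in>word_cong S R `` {v}. word_cong S R `` {u @ v})"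
    by (intro SUP_cong refl word_class_eq word_cong.sym[OF word_cong.append])
      (simp_all add: assms)
  moreover have "u \<in> word_cong S R `` {u}" "v \<in> word_cong S R `` {v}"
    using assms by (simp_all add: word_cong.refl)
  ultimately show ?thesis
    by (simp only: presented_group_def monoid.simps UN_constant) (metis empty_iff)
qed

lemma word_left_inverse:
  assumes "w \<in> words S"
  shows "\<exists>w' \<in> words S. (w' @ w, []) \<in> word_cong S R"
  using assms
proof (induction w)
  case Nil
  show ?case by (rule bexI[of _ "[]"]) (simp_all add: word_cong.refl)
next
  case (Cons a w)
  have a: "a \<in> Gen ` S \<union> Inv ` S" and w: "w \<in> words S"
    using Cons.prems by (auto simp: words_def)
  obtain w' where w': "w' \<in> words S" "(w' @ w, []) \<in> word_cong S R"
    using Cons.IH w by blast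
  obtain a' where a': "[a'] \<in> words S" "([a', a], []) \<in> word_cong S R"
  proof -
    from a consider x where "x \<in> S" "a = Gen x" | x where "x \<in> S" "a = Inv x"
      by blast
    then show thesis
    proof cases
      case 1
      then show ?thesis using that[of "Inv x"] by (simp add: words_def word_cong.Inv_Gen)
    next
      case 2
      then show ?thesis using that[of "Gen x"] by (simp add: words_def word_cong.Gen_Inv)
    qed
  qed
  have "([a', a] @ w, [] @ w) \<in> word_cong S R"
    using a'(2) w by (intro word_cong.append word_cong.refl)
  then have "(w' @ [a', a] @ w, w' @ [] @ w) \<in> word_cong S R"
    by (rule word_cong.append[OF word_cong.refl[OF w'(1)]])
  then have "((w' @ [a']) @ a # w, w' @ w) \<in> word_cong S R"
    by simp
  then have "((w' @ [a']) @ a # w, []) \<in> word_cong S R"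
    using w'(2) by (rule word_cong.trans)
  moreover have "w' @ [a'] \<in> words S"
    using w'(1) a'(1) by simp
  ultimately show ?case by blast
qed

lemma group_presented_group: "group (presented_group S R)"
proof -
  have car: "carrier (presented_group S R) = words S // word_cong S R"
    and one: "\<one>\<^bsub>presented_group S R\<^esub> = word_cong S R `` {[]}"
    by (simp_all add: presented_group_def)
  show ?thesis
  proof (rule groupI, goal_cases)
    case (1 x y)
    then show ?case
      unfolding car by (elim quotientE) (simp add: mult_word_class quotientI)
  next
    case 2
    then show ?case by (simp add: car one quotientI)
  next
    case (3 x y z)
    then show ?case
      unfolding car by (elim quotientE) (simp add: mult_word_class)
  next
    case (4 x)
    then show ?case
      unfolding car one by (elim quotientE) (simp add: mult_word_class)
  next
    case (5 x)
    then obtain w where w: "w \<in> words S" "x = word_cong S R `` {w}"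
      by (auto simp: car elim: quotientE)
    obtain w' where w': "w' \<in> words S" "(w' @ w, []) \<in> word_cong S R"
      using word_left_inverse[OF w(1)] by blast
    show ?case
    proof (rule bexI)
      show "word_cong S R `` {w'} \<otimes>\<^bsub>presented_group S R\<^esub> x = \<one>\<^bsub>presented_group S R\<^esub>"
        using w w' by (simp only: one mult_word_class word_class_eq)
      show "word_cong S R `` {w'} \<in> carrier (presented_group S R)"
        using w'(1) by (simp add: car quotientI)
    qed
  qed
qed

definition mult_table ::
  "('a \<Rightarrow> 'x) \<Rightarrow> ('a, 'm) monoid_scheme \<Rightarrow> ('x letter list \<times> 'x letter list) set" where
  "mult_table f G =
     {([Gen (f x), Gen (f y)], [Gen (f (x \<otimes>\<^bsub>G\<^esub> y))]) | x y. x \<in> carrier G \<and> y \<in> carrier G}"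

datatype 'a hnn_gen = Base 'a | Stable

definition HNN ::
  "('a, 'm) monoid_scheme \<Rightarrow> 'a set \<Rightarrow> ('a \<Rightarrow> 'a) \<Rightarrow> 'a hnn_gen letter list set monoid" where
  "HNN G A \<phi> =
     presented_group (Base ` carrier G \<union> {Stable})
       (mult_table Base G \<union>
        {([Inv Stable, Gen (Base a), Gen Stable], [Gen (Base (\<phi> a))]) | a. a \<in> A})"

definition amalgamated_product ::
  "('a, 'm) monoid_scheme \<Rightarrow> ('b, 'n) monoid_scheme \<Rightarrow> 'a set \<Rightarrow> ('a \<Rightarrow> 'b) \<Rightarrow>
   ('a + 'b) letter list set monoid" where
  "amalgamated_product G H A \<phi> =
     presented_group (Inl ` carrier G \<union> Inr ` carrier H)
       (mult_table Inl G \<union> mult_table Inr H \<union>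
        {([Gen (Inl a)], [Gen (Inr (\<phi> a))]) | a. a \<in> A})"

lemma group_HNN: "group (HNN G A \<phi>)"
  by (simp add: HNN_def group_presented_group)

lemma group_amalgamated_product: "group (amalgamated_product G H A \<phi>)"
  by (simp add: amalgamated_product_def group_presented_group)

end

theory Submission
  imports Defs
begin

text \<open>
  In a CSA-group commuting is a transitive relation on nontrivial elements: if \<open>c \<noteq> \<one>\<close> commutes with
  \<open>a\<close> and with \<open>b\<close>, then \<open>c\<close> lies both in a maximal abelian subgroup through \<open>a\<close> and \<open>c\<close>
  and in its conjugate by \<open>b\<close>, so malnormality puts \<open>b\<close> into this subgroup (\<open>CSA_commute_transitive\<close>). Both constructions violate
  this transitivity. Since \<open>A\<close> and \<open>B\<close> are not maximal abelian, there are \<open>a \<notin> A\<close> centralizing \<open>A\<close>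
  and \<open>b \<notin> B\<close> centralizing \<open>B\<close>. For a nontrivial \<open>c \<in> A\<close>, which is identified with \<open>\<phi> c\<close> in the
  amalgamated product and equals \<open>t \<phi>(c) t^-1\<close> in the HNN-extension, the element \<open>c\<close> commutes with \<open>a\<close>
  and with \<open>b\<close>, respectively with \<open>t b t^-1\<close>. It remains to see that \<open>c\<close> is nontrivial and that \<open>a\<close>
  does not commute with \<open>b\<close>, respectively with \<open>t b t^-1\<close>.

  Normal form theorems would give this. Here a permutation representation tailored to the two
  elements replaces them. For a large index set \<open>N\<close>, the sets \<open>G \<times> N\<close> and \<open>H \<times> N\<close> are free over
  \<open>A\<close> and \<open>B\<close> with equally many orbits, so there is a bijection \<open>\<theta>\<close> from the first to the second
  that is equivariant along \<open>\<phi>\<close> (\<open>equivariant_bij\<close>). Letting \<open>G\<close> act on \<open>G \<times> N\<close> by left translation,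
  and \<open>H\<close> by left translation transported along \<open>\<theta>\<close>, defines an action of the amalgamated product.
  If \<open>H = G\<close>, then sending the stable letter to the inverse of \<open>\<theta>\<close> defines an action of the
  HNN-extension, and \<open>t b t^-1\<close> acts as the transported translation by \<open>b\<close>. Translations are free,
  so \<open>c\<close> acts nontrivially in both cases. The bijection is not unique: shifting an additional
  integer coordinate on a single \<open>A\<close>-orbit keeps it equivariant, and the orbit can be chosen such
  that the actions of \<open>a\<close> and of the transported \<open>b\<close> no longer commute
  (\<open>noncommuting_equivariant_bij\<close>).
\<close>

section \<open>Commutation in CSA-groups\<close>

lemma abelian_subgroup_commute:
  assumes "abelian_subgroup K G" "x \<in> K" "y \<in> K"
  shows "x \<otimes>\<^bsub>G\<^esub> y = y \<otimes>\<^bsub>G\<^esub> x"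
  using assms comm_monoid.m_comm[of "G\<lparr>carrier := K\<rparr>" x y]
  by (auto simp: abelian_subgroup_def comm_group_def)

lemma not_maximal_abelianE:
  assumes "abelian_subgroup A G" "\<not> maximal_abelian A G"
  obtains a where "a \<in> carrier G" "a \<notin> A" "\<And>x. x \<in> A \<Longrightarrow> a \<otimes>\<^bsub>G\<^esub> x = x \<otimes>\<^bsub>G\<^esub> a"
proof -
  obtain L where L: "abelian_subgroup L G" "A \<subseteq> L" "L \<noteq> A"
    using assms by (auto simp: maximal_abelian_def)
  then obtain a where "a \<in> L" "a \<notin> A"
    by blast
  moreover have "L \<subseteq> carrier G"
    using L by (auto simp: abelian_subgroup_def dest: subgroup.subset)
  ultimately show thesis
    using that[of a] L abelian_subgroup_commute[OF L(1)] by blast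
qed

lemma (in group) inv_commute:
  assumes "x \<in> carrier G" "y \<in> carrier G" "x \<otimes> y = y \<otimes> x"
  shows "inv x \<otimes> y = y \<otimes> inv x"
proof -
  have "y \<otimes> inv x = inv x \<otimes> (x \<otimes> y) \<otimes> inv x"
    using assms(1,2) by (simp add: m_assoc[symmetric])
  also have "\<dots> = inv x \<otimes> y"
    unfolding assms(3) using assms(1,2) by (simp add: m_assoc)
  finally show ?thesis ..
qed

text \<open>
  By Zorn's lemma the given elements lie in a maximal set \<open>K\<close> of pairwise commuting elements. Every
  element of the group that commutes with all of \<open>K\<close> belongs to \<open>K\<close>, and this makes \<open>K\<close> a subgroup.
\<close>

lemma (in group) maximal_abelian_superset:
  assumes "S \<subseteq> carrier G" and commute: "\<And>x y. x \<in> S \<Longrightarrow> y \<in> S \<Longrightarrow> x \<otimes> y = y \<otimes> x"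
  obtains K where "maximal_abelian K G" "S \<subseteq> K"
proof -
  define \<C> where "\<C> = {K. S \<subseteq> K \<and> K \<subseteq> carrier G \<and> (\<forall>x\<in>K. \<forall>y\<in>K. x \<otimes> y = y \<otimes> x)}"
  have "\<exists>M\<in>\<C>. \<forall>X\<in>\<C>. M \<subseteq> X \<longrightarrow> X = M"
  proof (rule subset_Zorn_nonempty)
    show "\<C> \<noteq> {}"
      unfolding \<C>_def using assms by blast
    show "\<Union>\<D> \<in> \<C>" if "\<D> \<noteq> {}" "subset.chain \<C> \<D>" for \<D>
    proof -
      have sub: "\<D> \<subseteq> \<C>" and chain: "\<And>X Y. X \<in> \<D> \<Longrightarrow> Y \<in> \<D> \<Longrightarrow> X \<subseteq> Y \<or> Y \<subseteq> X"
        using that(2) by (auto simp: subset_chain_def)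
      have "x \<otimes> y = y \<otimes> x" if xy: "x \<in> X" "X \<in> \<D>" "y \<in> Y" "Y \<in> \<D>" for x y X Y
      proof -
        obtain Z where "Z \<in> \<D>" "x \<in> Z" "y \<in> Z"
          using chain[OF xy(2,4)] xy by blast
        then show ?thesis
          using sub by (auto simp: \<C>_def)
      qed
      then have "\<forall>x\<in>\<Union>\<D>. \<forall>y\<in>\<Union>\<D>. x \<otimes> y = y \<otimes> x"
        by blast
      moreover have "S \<subseteq> X" "X \<subseteq> carrier G" if "X \<in> \<D>" for X
        using sub that by (auto simp: \<C>_def)
      then have "S \<subseteq> \<Union>\<D>" "\<Union>\<D> \<subseteq> carrier G"
        using that(1) by blast+
      ultimately show ?thesis
        by (simp add: \<C>_def)
    qed
  qed
  then obtain K where K: "K \<in> \<C>" and max: "\<And>X. X \<in> \<C> \<Longrightarrow> K \<subseteq> X \<Longrightarrow> X = K"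
    by blast
  have S: "S \<subseteq> K" and car: "K \<subseteq> carrier G"
    and comm: "\<And>x y. x \<in> K \<Longrightarrow> y \<in> K \<Longrightarrow> x \<otimes> y = y \<otimes> x"
    using K by (auto simp: \<C>_def)
  have absorb: "z \<in> K" if z: "z \<in> carrier G" "\<And>x. x \<in> K \<Longrightarrow> z \<otimes> x = x \<otimes> z" for z
  proof -
    have "x \<otimes> y = y \<otimes> x" if "x \<in> insert z K" "y \<in> insert z K" for x y
      using that z(2)[of x] z(2)[of y] comm[of x y] by (metis insertE)
    then have "insert z K \<in> \<C>"
      unfolding \<C>_def using z(1) S car by blast
    from max[OF this] show ?thesis
      by blast
  qed
  have sub: "subgroup K G"
  proof (rule subgroupI)
    show "K \<subseteq> carrier G"
      by (rule car)
    have "\<one> \<in> K"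
      using car by (intro absorb) auto
    then show "K \<noteq> {}"
      by blast
    show "inv x \<in> K" if x: "x \<in> K" for x
    proof (rule absorb)
      show "inv x \<in> carrier G"
        using x car by blast
      show "inv x \<otimes> y = y \<otimes> inv x" if "y \<in> K" for y
        using inv_commute[OF _ _ comm[OF x that]] x that car by (simp add: subset_iff)
    qed
    show "x \<otimes> y \<in> K" if xy: "x \<in> K" "y \<in> K" for x y
    proof (rule absorb)
      show "x \<otimes> y \<in> carrier G"
        using xy car by blast
      show "x \<otimes> y \<otimes> z = z \<otimes> (x \<otimes> y)" if z: "z \<in> K" for z
      proof -
        have in_car: "x \<in> carrier G" "y \<in> carrier G" "z \<in> carrier G"
          using xy z car by (simp_all add: subset_iff)
        have "x \<otimes> y \<otimes> z = x \<otimes> (z \<otimes> y)"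
          using in_car by (simp add: m_assoc comm[OF xy(2) z])
        also have "\<dots> = z \<otimes> (x \<otimes> y)"
          using in_car by (simp add: m_assoc[symmetric] comm[OF xy(1) z])
        finally show ?thesis .
      qed
    qed
  qed
  interpret K: group "G\<lparr>carrier := K\<rparr>"
    using sub by (rule subgroup_imp_group)
  have "comm_group (G\<lparr>carrier := K\<rparr>)"
    by (rule K.group_comm_groupI) (simp add: comm)
  then have "abelian_subgroup K G"
    using sub by (simp add: abelian_subgroup_def)
  moreover have "L = K" if L: "abelian_subgroup L G" "K \<subseteq> L" for L
  proof (rule max)
    show "L \<in> \<C>"
      unfolding \<C>_def
      using L S abelian_subgroup_commute[OF L(1)] subgroup.subset[of L G]
      by (simp add: abelian_subgroup_def)
  qed (fact L(2))
  ultimately show thesis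
    using that[OF _ S] unfolding maximal_abelian_def by blast
qed

text \<open>
  If \<open>b\<close> were outside a maximal abelian \<open>K\<close> containing \<open>a\<close> and \<open>c\<close>, then \<open>c = b^-1 c b\<close> would be a
  nontrivial element of \<open>K\<close> and of its conjugate by \<open>b\<close>.
\<close>

lemma (in group) CSA_commute_transitive:
  assumes CSA: "CSA G" and car: "a \<in> carrier G" "b \<in> carrier G" "c \<in> carrier G" and "c \<noteq> \<one>"
    and ac: "a \<otimes> c = c \<otimes> a" and bc: "b \<otimes> c = c \<otimes> b"
  shows "a \<otimes> b = b \<otimes> a"
proof -
  obtain K where K: "maximal_abelian K G" "{a, c} \<subseteq> K"
    by (rule maximal_abelian_superset[of "{a, c}"]) (use car ac in auto)
  have "malnormal K G"
    using CSA K(1) by (simp add: CSA_def)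
  have "b \<in> K"
  proof (rule ccontr)
    assume "b \<notin> K"
    then have *: "K \<inter> ((inv b <# K) #> b) = {\<one>}"
      using \<open>malnormal K G\<close> car by (auto simp: malnormal_def)
    have "c = inv b \<otimes> c \<otimes> b"
      using car bc by (metis inv_solve_left m_assoc m_closed inv_closed)
    then have "c \<in> (inv b <# K) #> b"
      using K(2) by (auto simp: l_coset_def r_coset_def)
    then show False
      using * K(2) \<open>c \<noteq> \<one>\<close> by blast
  qed
  then show ?thesis
    using K abelian_subgroup_commute[of K G a b] by (auto simp: maximal_abelian_def)
qed

section \<open>Words in a presented group\<close>

lemma CSA_presented_group_commute:
  assumes CSA: "CSA (presented_group S R)"
    and w: "a \<in> words S" "b \<in> words S" "c \<in> words S"
    and c: "(c, []) \<notin> word_cong S R"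
    and ac: "(a @ c, c @ a) \<in> word_cong S R" and bc: "(b @ c, c @ b) \<in> word_cong S R"
  shows "(a @ b, b @ a) \<in> word_cong S R"
proof -
  let ?P = "presented_group S R"
  let ?cl = "\<lambda>w. word_cong S R `` {w}"
  have car: "?cl u \<in> carrier ?P" if "u \<in> words S" for u
    using that by (simp add: presented_group_def quotientI)
  have eq: "?cl u = ?cl v \<longleftrightarrow> (u, v) \<in> word_cong S R" if "u \<in> words S" "v \<in> words S" for u v
    using eq_equiv_class_iff[OF equiv_word_cong that] .
  have "?cl a \<otimes>\<^bsub>?P\<^esub> ?cl b = ?cl b \<otimes>\<^bsub>?P\<^esub> ?cl a"
  proof (rule group.CSA_commute_transitive[OF group_presented_group CSA])
    show "?cl c \<noteq> \<one>\<^bsub>?P\<^esub>"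
      using c eq[OF w(3), of "[]"] by (simp add: presented_group_def)
  qed (use w ac bc in \<open>simp_all add: car mult_word_class eq\<close>)
  then show ?thesis
    using w by (simp add: mult_word_class eq)
qed

lemma words_Gen_Cons [simp]: "Gen x # w \<in> words S \<longleftrightarrow> x \<in> S \<and> w \<in> words S"
  by (auto simp: words_def)

lemma words_Inv_Cons [simp]: "Inv x # w \<in> words S \<longleftrightarrow> x \<in> S \<and> w \<in> words S"
  by (auto simp: words_def)

lemma word_cong_context:
  assumes "(u, v) \<in> word_cong S R" "p \<in> words S" "s \<in> words S"
  shows "(p @ u @ s, p @ v @ s) \<in> word_cong S R"
  using assms by (intro word_cong.append word_cong.refl)

lemma word_cong_mult_table_commute:
  assumes "mult_table f G \<subseteq> R" "f ` carrier G \<subseteq> S" "x \<in> carrier G" "y \<in> carrier G"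
    and "x \<otimes>\<^bsub>G\<^esub> y = y \<otimes>\<^bsub>G\<^esub> x" "group G"
  shows "([Gen (f x), Gen (f y)], [Gen (f y), Gen (f x)]) \<in> word_cong S R"
proof -
  have *: "([Gen (f x), Gen (f y)], [Gen (f (x \<otimes>\<^bsub>G\<^esub> y))]) \<in> word_cong S R"
    if "x \<in> carrier G" "y \<in> carrier G" for x y
    by (rule word_cong.relation)
      (use that assms(1,2) monoid.m_closed[OF group.is_monoid[OF \<open>group G\<close>] that] in
        \<open>auto simp: mult_table_def words_def image_subset_iff\<close>)
  show ?thesis
    using *[OF assms(3,4)] word_cong.sym[OF *[OF assms(4,3)]] unfolding assms(5)
    by (rule word_cong.trans)
qed

text \<open>
  If \<open>t^-1 x t = y\<close> and \<open>b\<close> commutes with \<open>y\<close>, then \<open>t b t^-1\<close> commutes with \<open>t y t^-1 = x\<close>. This lets the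
  stable letter of an HNN-extension carry a commutation from \<open>B\<close> back to \<open>A\<close>.
\<close>

lemma word_cong_conjugate_commute:
  assumes t: "t \<in> S" and conj: "(Inv t # x @ [Gen t], y) \<in> word_cong S R"
    and comm: "(b @ y, y @ b) \<in> word_cong S R"
  shows "((Gen t # b @ [Inv t]) @ x, x @ Gen t # b @ [Inv t]) \<in> word_cong S R"
proof -
  note [trans] = word_cong.trans
  have w: "x \<in> words S" "y \<in> words S" "b \<in> words S"
    using word_cong_words[OF conj] word_cong_words[OF comm] by simp_all
  have tT: "([Gen t, Inv t], []) \<in> word_cong S R"
    using t by (rule word_cong.Gen_Inv)
  have "(Gen t # b @ Inv t # x, Gen t # b @ Inv t # x @ [Gen t, Inv t]) \<in> word_cong S R"
    using word_cong_context[OF word_cong.sym[OF tT], of "Gen t # b @ Inv t # x" "[]"] t w by simp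
  also have "(Gen t # b @ Inv t # x @ [Gen t, Inv t], Gen t # b @ y @ [Inv t]) \<in> word_cong S R"
    using word_cong_context[OF conj, of "Gen t # b" "[Inv t]"] t w by simp
  also have "(Gen t # b @ y @ [Inv t], Gen t # y @ b @ [Inv t]) \<in> word_cong S R"
    using word_cong_context[OF comm, of "[Gen t]" "[Inv t]"] t w by simp
  also have "(Gen t # y @ b @ [Inv t], Gen t # Inv t # x @ Gen t # b @ [Inv t]) \<in> word_cong S R"
    using word_cong_context[OF word_cong.sym[OF conj], of "[Gen t]" "b @ [Inv t]"] t w by simp
  also have "(Gen t # Inv t # x @ Gen t # b @ [Inv t], x @ Gen t # b @ [Inv t]) \<in> word_cong S R"
    using word_cong_context[OF tT, of "[]" "x @ Gen t # b @ [Inv t]"] t w by simp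
  finally show ?thesis
    by simp
qed

text \<open>
  The maps assigned to generators and to their inverses are two separate parameters, because they
  need to be mutually inverse only on a subset of the type \<open>'p\<close>.
\<close>

definition act :: "('x \<Rightarrow> 'p \<Rightarrow> 'p) \<Rightarrow> ('x \<Rightarrow> 'p \<Rightarrow> 'p) \<Rightarrow> 'x letter list \<Rightarrow> 'p \<Rightarrow> 'p" where
  "act F F' w = foldr (case_letter F F') w"

lemma act_simps [simp]:
  "act F F' [] p = p"
  "act F F' (Gen x # w) p = F x (act F F' w p)"
  "act F F' (Inv x # w) p = F' x (act F F' w p)"
  by (simp_all add: act_def)

lemma act_append: "act F F' (u @ v) p = act F F' u (act F F' v p)"
  by (simp add: act_def)

text \<open>
  This is the universal property of a presentation, for actions on a set \<open>X\<close>: it suffices to respect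
  the defining relations. Words that act differently therefore represent different elements.
\<close>

lemma word_cong_act:
  assumes "(u, v) \<in> word_cong S R" "p \<in> X"
    and F: "\<And>x p. x \<in> S \<Longrightarrow> p \<in> X \<Longrightarrow> F x p \<in> X \<and> F' x p \<in> X"
    and inverse: "\<And>x p. x \<in> S \<Longrightarrow> p \<in> X \<Longrightarrow> F' x (F x p) = p \<and> F x (F' x p) = p"
    and relation: "\<And>u v p. (u, v) \<in> R \<Longrightarrow> p \<in> X \<Longrightarrow> act F F' u p = act F F' v p"
  shows "act F F' u p = act F F' v p"
proof -
  have closed: "act F F' w p \<in> X" if "w \<in> words S" "p \<in> X" for w p
    using that(1) unfolding words_def
    by (induction w) (use that(2) F in auto)
  show ?thesis
    using assms(1,2)
  proof (induction arbitrary: p)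
    case (append u u' v v')
    then show ?case
      using closed[of v' p] word_cong_words[OF append.hyps(2)] by (simp add: act_append)
  next
    case (sym u v)
    then show ?case
      by metis
  next
    case (trans u v w)
    then show ?case
      by metis
  next
    case (relation u v)
    then show ?case
      using assms(5) by blast
  qed (simp_all add: inverse)
qed

section \<open>A bijection that intertwines two translation actions\<close>

definition translate :: "('a, 'm) monoid_scheme \<Rightarrow> 'a \<Rightarrow> 'a \<times> 'n \<Rightarrow> 'a \<times> 'n" where
  "translate G x p = (x \<otimes>\<^bsub>G\<^esub> fst p, snd p)"

context group
begin

lemma translate_closed:
  "x \<in> carrier G \<Longrightarrow> p \<in> carrier G \<times> N \<Longrightarrow> translate G x p \<in> carrier G \<times> N"
  by (auto simp: translate_def)

lemma translate_mult:
  "x \<in> carrier G \<Longrightarrow> y \<in> carrier G \<Longrightarrow> p \<in> carrier G \<times> N \<Longrightarrow>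
    translate G x (translate G y p) = translate G (x \<otimes> y) p"
  by (auto simp: translate_def m_assoc)

lemma translate_one: "p \<in> carrier G \<times> N \<Longrightarrow> translate G \<one> p = p"
  by (auto simp: translate_def)

lemma translate_free:
  "x \<in> carrier G \<Longrightarrow> p \<in> carrier G \<times> N \<Longrightarrow> translate G x p = p \<Longrightarrow> x = \<one>"
  by (auto simp: translate_def)

lemma translate_inverse:
  "x \<in> carrier G \<Longrightarrow> p \<in> carrier G \<times> N \<Longrightarrow>
    translate G (inv x) (translate G x p) = p \<and> translate G x (translate G (inv x) p) = p"
  by (auto simp: translate_def m_assoc[symmetric])

end

text \<open>
  A choice of coset representatives splits \<open>G\<close>, under left translation by \<open>A\<close>, into copies of \<open>A\<close>
  indexed by the right cosets.
\<close>

lemma (in group) subgroup_times_rcosets_bij: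
  assumes A: "subgroup A G"
  obtains f where "bij_betw f (carrier G) (A \<times> rcosets A)"
    and "\<And>x g. x \<in> A \<Longrightarrow> g \<in> carrier G \<Longrightarrow> f (x \<otimes> g) = (x \<otimes> fst (f g), snd (f g))"
proof
  interpret A: subgroup A G by (fact A)
  define r where "r C = (SOME y. y \<in> C)" for C :: "'a set"
  define f where "f g = (g \<otimes> inv r (A #> g), A #> g)" for g
  have r: "r C \<in> C" "r C \<in> carrier G" if C: "C \<in> rcosets A" for C
  proof -
    have "\<exists>y. y \<in> C"
      using C A.rcosets_non_empty by blast
    then show "r C \<in> C"
      unfolding r_def by (rule someI_ex)
    then show "r C \<in> carrier G"
      using C A.rcosets_carrier[OF group_axioms C] by blast
  qed
  have coset: "A #> g \<in> rcosets A" if "g \<in> carrier G" for g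
    using that A.subset by (rule rcosetsI[rotated])
  have absorb: "A #> (x \<otimes> g) = A #> g" if "x \<in> A" "g \<in> carrier G" for x g
    using coset_mult_assoc[OF A.subset, of x g] coset_join2[OF _ A, of x] that by simp
  have inA: "g \<otimes> inv r (A #> g) \<in> A" if g: "g \<in> carrier G" for g
  proof -
    obtain x where "x \<in> A" "r (A #> g) = x \<otimes> g"
      using r(1)[OF coset[OF g]] by (auto simp: r_coset_def)
    then show ?thesis
      using g by (simp add: inv_mult_group m_assoc[symmetric])
  qed
  show "bij_betw f (carrier G) (A \<times> rcosets A)"
  proof (rule bij_betw_byWitness[where f' = "\<lambda>(x, C). x \<otimes> r C"])
    show "\<forall>g\<in>carrier G. (\<lambda>(x, C). x \<otimes> r C) (f g) = g"
      using r(2)[OF coset] by (auto simp: f_def m_assoc)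
    show "f ` carrier G \<subseteq> A \<times> rcosets A"
      using inA coset by (auto simp: f_def)
    show "(\<lambda>(x, C). x \<otimes> r C) ` (A \<times> rcosets A) \<subseteq> carrier G"
      using r(2) by auto
    have "A #> (x \<otimes> r C) = C" if xC: "x \<in> A" "C \<in> rcosets A" for x C
    proof -
      obtain g where g: "g \<in> carrier G" "C = A #> g"
        using xC(2) by (auto simp: RCOSETS_def)
      obtain y where y: "y \<in> A" "r C = y \<otimes> g"
        using r(1)[OF xC(2)] by (auto simp: g(2) r_coset_def)
      have "x \<otimes> r C = (x \<otimes> y) \<otimes> g"
        using that(1) y g(1) by (simp add: m_assoc)
      then show ?thesis
        using absorb[of "x \<otimes> y" g] that(1) y(1) g by simp
    qed
    then show "\<forall>p\<in>A \<times> rcosets A. f (case p of (x, C) \<Rightarrow> x \<otimes> r C) = p"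
      using r(2) by (auto simp: f_def m_assoc)
  qed
  show "f (x \<otimes> g) = (x \<otimes> fst (f g), snd (f g))" if "x \<in> A" "g \<in> carrier G" for x g
    using that r(2)[OF coset] by (simp add: f_def m_assoc absorb)
qed

text \<open>
  As an \<open>A\<close>-set, \<open>G \<times> L\<close> is a disjoint union of copies of \<open>A\<close> indexed by the product of the set of
  right cosets with \<open>L\<close>, and likewise for \<open>H\<close> and \<open>B\<close>. The type of lists over cosets is infinite and
  at least as large as either set of cosets, so it absorbs both of them and leaves equally many
  copies on the two sides.
\<close>

lemma equivariant_bij:
  includes cardinal_syntax
  fixes G :: "('a, 'm) monoid_scheme" and H :: "('b, 'n) monoid_scheme"
  assumes G: "group G" and H: "group H" and A: "subgroup A G" and B: "subgroup B H"
    and \<phi>: "\<phi> \<in> iso (G\<lparr>carrier := A\<rparr>) (H\<lparr>carrier := B\<rparr>)"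
  obtains \<theta> :: "'a \<times> ('a set + 'b set) list \<Rightarrow> 'b \<times> ('a set + 'b set) list"
  where "bij_betw \<theta> (carrier G \<times> UNIV) (carrier H \<times> UNIV)"
    and "\<And>x p. x \<in> A \<Longrightarrow> p \<in> carrier G \<times> UNIV \<Longrightarrow>
      \<theta> (translate G x p) = translate H (\<phi> x) (\<theta> p)"
proof -
  let ?L = "UNIV :: ('a set + 'b set) list set"
  obtain f where f: "bij_betw f (carrier G) (A \<times> rcosets\<^bsub>G\<^esub> A)"
    and f_mult: "\<And>x g. x \<in> A \<Longrightarrow> g \<in> carrier G \<Longrightarrow>
      f (x \<otimes>\<^bsub>G\<^esub> g) = (x \<otimes>\<^bsub>G\<^esub> fst (f g), snd (f g))"
    using group.subgroup_times_rcosets_bij[OF G A] by blast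
  obtain h where h: "bij_betw h (carrier H) (B \<times> rcosets\<^bsub>H\<^esub> B)"
    and h_mult: "\<And>x g. x \<in> B \<Longrightarrow> g \<in> carrier H \<Longrightarrow>
      h (x \<otimes>\<^bsub>H\<^esub> g) = (x \<otimes>\<^bsub>H\<^esub> fst (h g), snd (h g))"
    using group.subgroup_times_rcosets_bij[OF H B] by blast
  have "|rcosets\<^bsub>G\<^esub> A| \<le>o |?L|" "|rcosets\<^bsub>H\<^esub> B| \<le>o |?L|"
    by (rule card_of_ordLeqI[where f = "\<lambda>C. [Inl C]"]; simp add: inj_on_def)
      (rule card_of_ordLeqI[where f = "\<lambda>C. [Inr C]"]; simp add: inj_on_def)
  moreover have "rcosets\<^bsub>G\<^esub> A \<noteq> {}" "rcosets\<^bsub>H\<^esub> B \<noteq> {}"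
    using subgroup.subgroup_in_rcosets[OF A G] subgroup.subgroup_in_rcosets[OF B H] by blast+
  ultimately have "|(rcosets\<^bsub>G\<^esub> A) \<times> ?L| =o |?L|" "|(rcosets\<^bsub>H\<^esub> B) \<times> ?L| =o |?L|"
    using card_of_Times_infinite[OF infinite_UNIV_listI] by blast+
  then have "|(rcosets\<^bsub>G\<^esub> A) \<times> ?L| =o |(rcosets\<^bsub>H\<^esub> B) \<times> ?L|"
    using ordIso_symmetric ordIso_transitive by blast
  then obtain \<psi> where \<psi>: "bij_betw \<psi> ((rcosets\<^bsub>G\<^esub> A) \<times> ?L) ((rcosets\<^bsub>H\<^esub> B) \<times> ?L)"
    using card_of_ordIso by blast
  have \<phi>_bij: "bij_betw \<phi> A B"
    using \<phi> by (simp add: iso_def)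
  have \<phi>_mult: "\<phi> (x \<otimes>\<^bsub>G\<^esub> y) = \<phi> x \<otimes>\<^bsub>H\<^esub> \<phi> y" if "x \<in> A" "y \<in> A" for x y
    using \<phi> that by (simp add: iso_def hom_def)
  define h' where "h' = the_inv_into (carrier H) h"
  have h': "bij_betw h' (B \<times> rcosets\<^bsub>H\<^esub> B) (carrier H)"
    unfolding h'_def using h by (rule bij_betw_the_inv_into)
  have h'_mult: "h' (x \<otimes>\<^bsub>H\<^esub> y, D) = x \<otimes>\<^bsub>H\<^esub> h' (y, D)"
    if "x \<in> B" "y \<in> B" "D \<in> rcosets\<^bsub>H\<^esub> B" for x y D
  proof -
    have car: "h' (y, D) \<in> carrier H"
      using h' that by (auto dest: bij_betwE)
    have "h (h' (y, D)) = (y, D)"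
      unfolding h'_def using h that by (intro f_the_inv_into_f_bij_betw) auto
    then have "h (x \<otimes>\<^bsub>H\<^esub> h' (y, D)) = (x \<otimes>\<^bsub>H\<^esub> y, D)"
      using that car by (simp add: h_mult)
    moreover have "x \<otimes>\<^bsub>H\<^esub> h' (y, D) \<in> carrier H"
      using group.is_monoid[OF H] car subgroup.mem_carrier[OF B] that
      by (simp add: monoid.m_closed)
    ultimately show ?thesis
      unfolding h'_def using h by (metis bij_betw_imp_inj_on the_inv_into_f_f)
  qed
  define \<theta> where "\<theta> = map_prod h' id \<circ> (\<lambda>(y, D, m). ((y, D), m)) \<circ> map_prod \<phi> \<psi> \<circ>
      (\<lambda>((x, C), l). (x, C, l)) \<circ> map_prod f id"
  show thesis
  proof (rule that)
    have fE: "\<exists>x C. f g = (x, C) \<and> x \<in> A \<and> C \<in> rcosets\<^bsub>G\<^esub> A" if "g \<in> carrier G" for g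
      using f that by (auto dest!: bij_betwE)
    have \<psi>E: "\<exists>D m. \<psi> (C, l) = (D, m) \<and> D \<in> rcosets\<^bsub>H\<^esub> B" if "C \<in> rcosets\<^bsub>G\<^esub> A" for C l
      using \<psi> that by (fastforce dest!: bij_betwE)
    have \<phi>B: "\<phi> x \<in> B" if "x \<in> A" for x
      using \<phi>_bij that by (auto dest: bij_betwE)
    show "bij_betw \<theta> (carrier G \<times> UNIV) (carrier H \<times> UNIV)"
      unfolding \<theta>_def
    proof (intro bij_betw_trans)
      show "bij_betw (map_prod f id) (carrier G \<times> ?L) ((A \<times> rcosets\<^bsub>G\<^esub> A) \<times> ?L)"
        using f by (intro bij_betw_map_prod) auto
      show "bij_betw (map_prod h' id) ((B \<times> rcosets\<^bsub>H\<^esub> B) \<times> ?L) (carrier H \<times> ?L)"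
        using h' by (intro bij_betw_map_prod) auto
      show "bij_betw (map_prod \<phi> \<psi>) (A \<times> (rcosets\<^bsub>G\<^esub> A) \<times> ?L) (B \<times> (rcosets\<^bsub>H\<^esub> B) \<times> ?L)"
        using \<phi>_bij \<psi> by (rule bij_betw_map_prod)
      show "bij_betw (\<lambda>((x, C), l). (x, C, l)) ((A \<times> rcosets\<^bsub>G\<^esub> A) \<times> ?L) (A \<times> (rcosets\<^bsub>G\<^esub> A) \<times> ?L)"
        by (rule bij_betw_byWitness[where f' = "\<lambda>(x, C, l). ((x, C), l)"]) auto
      show "bij_betw (\<lambda>(y, D, m). ((y, D), m)) (B \<times> (rcosets\<^bsub>H\<^esub> B) \<times> ?L) ((B \<times> rcosets\<^bsub>H\<^esub> B) \<times> ?L)"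
        by (rule bij_betw_byWitness[where f' = "\<lambda>((y, D), m). (y, D, m)"]) auto
    qed
    show "\<theta> (translate G x p) = translate H (\<phi> x) (\<theta> p)"
      if x: "x \<in> A" and p: "p \<in> carrier G \<times> UNIV" for x p
    proof -
      obtain g l where gl: "p = (g, l)" "g \<in> carrier G"
        using p by auto
      obtain y C where 1: "f g = (y, C)" "y \<in> A" "C \<in> rcosets\<^bsub>G\<^esub> A"
        using fE gl(2) by blast
      obtain D m where 2: "\<psi> (C, l) = (D, m)" "D \<in> rcosets\<^bsub>H\<^esub> B"
        using \<psi>E 1 by blast
      show ?thesis
        using gl 1 2 x by (simp add: \<theta>_def translate_def f_mult \<phi>_mult h'_mult \<phi>B)
    qed
  qed
qed

text \<open>
  Let \<open>\<theta>\<^sub>0\<close> be any equivariant bijection, \<open>\<beta>\<close> the translation by \<open>b\<close> transported along it, and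
  \<open>q = a \<beta> u\<^sub>0\<close>. If \<open>q \<noteq> \<beta> a u\<^sub>0\<close>, there is nothing to repair. Otherwise an integer coordinate \<open>k\<close> is
  added, and \<open>\<theta>\<close> lowers it by one on the \<open>A\<close>-orbit of \<open>q\<close>. The new transported translation then
  changes \<open>k\<close> by \<open>\<delta> (\<beta> u) - \<delta> u\<close>, where \<open>\<delta>\<close> indicates this orbit. As \<open>a \<notin> A\<close>, the point
  \<open>\<beta> u\<^sub>0\<close> is not in the orbit of \<open>q = a \<beta> u\<^sub>0\<close>. As \<open>b \<notin> B\<close>, the point \<open>a u\<^sub>0\<close> is not in the orbit of
  \<open>q = \<beta> a u\<^sub>0\<close>. So, starting at \<open>u\<^sub>0\<close>, the change of \<open>k\<close> is \<open>0 - \<delta> u\<^sub>0 \<le> 0\<close> along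
  one order of the two maps and \<open>1 - 0\<close> along the other.
\<close>

lemma noncommuting_equivariant_bij:
  fixes G :: "('a, 'm) monoid_scheme" and H :: "('b, 'n) monoid_scheme"
  assumes G: "group G" and H: "group H" and A: "subgroup A G" and B: "subgroup B H"
    and \<phi>: "\<phi> \<in> iso (G\<lparr>carrier := A\<rparr>) (H\<lparr>carrier := B\<rparr>)"
    and a: "a \<in> carrier G" "a \<notin> A" and b: "b \<in> carrier H" "b \<notin> B"
  obtains \<theta> :: "'a \<times> ('a set + 'b set) list \<times> int \<Rightarrow> 'b \<times> ('a set + 'b set) list \<times> int"
    and \<eta> p
  where "\<And>p. p \<in> carrier G \<times> UNIV \<Longrightarrow> \<theta> p \<in> carrier H \<times> UNIV"
    and "\<And>q. q \<in> carrier H \<times> UNIV \<Longrightarrow> \<eta> q \<in> carrier G \<times> UNIV"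
    and "\<And>p. p \<in> carrier G \<times> UNIV \<Longrightarrow> \<eta> (\<theta> p) = p"
    and "\<And>q. q \<in> carrier H \<times> UNIV \<Longrightarrow> \<theta> (\<eta> q) = q"
    and "\<And>x p. x \<in> A \<Longrightarrow> p \<in> carrier G \<times> UNIV \<Longrightarrow>
      \<theta> (translate G x p) = translate H (\<phi> x) (\<theta> p)"
    and "p \<in> carrier G \<times> UNIV"
    and "translate G a (\<eta> (translate H b (\<theta> p))) \<noteq> \<eta> (translate H b (\<theta> (translate G a p)))"
proof -
  interpret G: group G by (fact G)
  interpret H: group H by (fact H)
  interpret A: subgroup A G by (fact A)
  interpret B: subgroup B H by (fact B)
  let ?X = "carrier G \<times> (UNIV :: ('a set + 'b set) list set)"
  let ?Y = "carrier H \<times> (UNIV :: ('a set + 'b set) list set)"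
  obtain \<theta>\<^sub>0 where bij: "bij_betw \<theta>\<^sub>0 ?X ?Y"
    and equiv: "\<And>x u. x \<in> A \<Longrightarrow> u \<in> ?X \<Longrightarrow>
      \<theta>\<^sub>0 (translate G x u) = translate H (\<phi> x) (\<theta>\<^sub>0 u)"
    using equivariant_bij[OF G H A B \<phi>] by metis
  define \<eta>\<^sub>0 where "\<eta>\<^sub>0 = the_inv_into ?X \<theta>\<^sub>0"
  have \<theta>\<^sub>0: "\<theta>\<^sub>0 u \<in> ?Y" "\<eta>\<^sub>0 (\<theta>\<^sub>0 u) = u" if "u \<in> ?X" for u
    using bij that by (auto simp: \<eta>\<^sub>0_def bij_betw_def the_inv_into_f_f)
  have \<eta>\<^sub>0: "\<eta>\<^sub>0 v \<in> ?X" "\<theta>\<^sub>0 (\<eta>\<^sub>0 v) = v" if "v \<in> ?Y" for v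
    using bij_betwE[OF bij_betw_the_inv_into[OF bij]] f_the_inv_into_f_bij_betw[OF bij] that
    by (auto simp: \<eta>\<^sub>0_def)
  have \<phi>B: "\<phi> x \<in> B" if "x \<in> A" for x
    using \<phi> that by (auto simp: iso_def dest: bij_betwE)
  define \<beta> where "\<beta> u = \<eta>\<^sub>0 (translate H b (\<theta>\<^sub>0 u))" for u
  have \<beta>: "\<beta> u \<in> ?X" if "u \<in> ?X" for u
    unfolding \<beta>_def using that b by (intro \<eta>\<^sub>0 H.translate_closed \<theta>\<^sub>0)
  define u\<^sub>0 where "u\<^sub>0 = (\<one>\<^bsub>G\<^esub>, [] :: ('a set + 'b set) list)"
  have u\<^sub>0: "u\<^sub>0 \<in> ?X"
    by (simp add: u\<^sub>0_def)
  define q where "q = translate G a (\<beta> u\<^sub>0)"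
  have q: "q \<in> ?X"
    unfolding q_def using a u\<^sub>0 by (intro G.translate_closed \<beta>)
  define \<delta> :: "_ \<Rightarrow> int" where "\<delta> u = of_bool (\<exists>x\<in>A. u = translate G x q)" for u
  have \<delta>_invariant: "\<delta> (translate G x u) = \<delta> u" if x: "x \<in> A" and u: "u \<in> ?X" for x u
  proof -
    have "(\<exists>y\<in>A. translate G x u = translate G y q) \<longleftrightarrow> (\<exists>y\<in>A. u = translate G y q)"
    proof safe
      fix y assume y: "y \<in> A" "translate G x u = translate G y q"
      have "u = translate G (inv\<^bsub>G\<^esub> x) (translate G x u)"
        using G.translate_inverse[of x u] x u by simp
      also have "\<dots> = translate G (inv\<^bsub>G\<^esub> x \<otimes>\<^bsub>G\<^esub> y) q"
        unfolding y(2) using x y q by (intro G.translate_mult) auto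
      finally show "\<exists>y\<in>A. u = translate G y q"
        using x y(1) by blast
    next
      fix y assume y: "y \<in> A"
      have "translate G x (translate G y q) = translate G (x \<otimes>\<^bsub>G\<^esub> y) q"
        using x y q by (intro G.translate_mult) auto
      then show "\<exists>z\<in>A. translate G x (translate G y q) = translate G z q"
        using x y by blast
    qed
    then show ?thesis
      by (simp add: \<delta>_def)
  qed
  have \<delta>_q: "\<delta> q = 1"
    using G.translate_one[OF q] A.one_closed by (auto simp: \<delta>_def intro!: bexI[of _ "\<one>\<^bsub>G\<^esub>"])
  have \<delta>_\<beta>: "\<delta> (\<beta> u\<^sub>0) = 0"
  proof -
    have "\<beta> u\<^sub>0 \<noteq> translate G x q" if x: "x \<in> A" for x
    proof
      assume "\<beta> u\<^sub>0 = translate G x q"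
      \<comment> \<open>by freeness \<open>x a = \<one>\<close>, which would put \<open>a\<close> into \<open>A\<close>\<close>
      also have "\<dots> = translate G (x \<otimes>\<^bsub>G\<^esub> a) (\<beta> u\<^sub>0)"
        unfolding q_def using x a \<beta>[OF u\<^sub>0] by (intro G.translate_mult) auto
      finally have "x \<otimes>\<^bsub>G\<^esub> a = \<one>\<^bsub>G\<^esub>"
        using x a G.translate_free[OF _ \<beta>[OF u\<^sub>0]] by simp
      then have "a = inv\<^bsub>G\<^esub> x"
        using x a G.inv_equality[of x a] G.inv_inv[of a] by simp
      then show False
        using x a(2) by simp
    qed
    then show ?thesis
      by (simp add: \<delta>_def)
  qed
  have \<delta>_a: "\<delta> (translate G a u\<^sub>0) = 0" if commute: "q = \<beta> (translate G a u\<^sub>0)"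
  proof -
    let ?w = "translate G a u\<^sub>0"
    have w: "?w \<in> ?X"
      using a u\<^sub>0 by (intro G.translate_closed)
    have "?w \<noteq> translate G x q" if x: "x \<in> A" for x
    proof
      assume "?w = translate G x q"
      \<comment> \<open>transported to \<open>H\<close>, freeness gives \<open>\<phi>(x) b = \<one>\<close>, which would put \<open>b\<close> into \<open>B\<close>\<close>
      then have "\<theta>\<^sub>0 ?w = translate H (\<phi> x) (\<theta>\<^sub>0 q)"
        using equiv[OF x q] by simp
      also have "\<theta>\<^sub>0 q = translate H b (\<theta>\<^sub>0 ?w)"
        unfolding commute \<beta>_def using w b by (intro \<eta>\<^sub>0 H.translate_closed \<theta>\<^sub>0)
      also have "translate H (\<phi> x) \<dots> = translate H (\<phi> x \<otimes>\<^bsub>H\<^esub> b) (\<theta>\<^sub>0 ?w)"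
        using \<phi>B[OF x] b \<theta>\<^sub>0(1)[OF w] by (intro H.translate_mult) auto
      finally have "\<phi> x \<otimes>\<^bsub>H\<^esub> b = \<one>\<^bsub>H\<^esub>"
        using \<phi>B[OF x] b H.translate_free[OF _ \<theta>\<^sub>0(1)[OF w]] by simp
      then have "b = inv\<^bsub>H\<^esub> (\<phi> x)"
        using \<phi>B[OF x] b H.inv_equality[of b "\<phi> x"] H.inv_comm[of "\<phi> x" b] by simp
      then show False
        using \<phi>B[OF x] b(2) by simp
    qed
    then show ?thesis
      by (simp add: \<delta>_def)
  qed
  define \<theta> where "\<theta> = (\<lambda>(g, l, k :: int).
      (fst (\<theta>\<^sub>0 (g, l)), snd (\<theta>\<^sub>0 (g, l)), k - \<delta> (g, l)))"
  define \<eta> where "\<eta> = (\<lambda>(h, l, k :: int).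
      (fst (\<eta>\<^sub>0 (h, l)), snd (\<eta>\<^sub>0 (h, l)), k + \<delta> (\<eta>\<^sub>0 (h, l))))"
  have sep: "translate G a (\<eta> (translate H b (\<theta> (fst u\<^sub>0, snd u\<^sub>0, 0)))) \<noteq>
      \<eta> (translate H b (\<theta> (translate G a (fst u\<^sub>0, snd u\<^sub>0, 0))))"
  proof (cases "q = \<beta> (translate G a u\<^sub>0)")
    case True
    have "\<delta> u\<^sub>0 \<ge> 0"
      by (simp add: \<delta>_def)
    then show ?thesis
      using True \<delta>_q \<delta>_\<beta> \<delta>_a
      by (simp add: \<theta>_def \<eta>_def \<beta>_def translate_def)
  next
    case False
    then show ?thesis
      by (auto simp: \<theta>_def \<eta>_def \<beta>_def q_def translate_def prod_eq_iff)
  qed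
  show thesis
  proof (rule that[of \<theta> \<eta>, OF _ _ _ _ _ _ sep])
    show "\<theta> (translate G x p) = translate H (\<phi> x) (\<theta> p)"
      if "x \<in> A" "p \<in> carrier G \<times> UNIV" for x p
      using that equiv[of x "(fst p, fst (snd p))"] \<delta>_invariant[of x "(fst p, fst (snd p))"]
      by (auto simp: \<theta>_def translate_def)
    show "\<theta> p \<in> carrier H \<times> UNIV" "\<eta> (\<theta> p) = p" if "p \<in> carrier G \<times> UNIV" for p
      using \<theta>\<^sub>0[of "(fst p, fst (snd p))"] that
      by (cases p; auto simp: \<theta>_def \<eta>_def mem_Times_iff)+
    show "\<eta> p \<in> carrier G \<times> UNIV" "\<theta> (\<eta> p) = p" if "p \<in> carrier H \<times> UNIV" for p
      using \<eta>\<^sub>0[of "(fst p, fst (snd p))"] that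
      by (cases p; auto simp: \<theta>_def \<eta>_def mem_Times_iff)+
    show "(fst u\<^sub>0, snd u\<^sub>0, 0) \<in> carrier G \<times> UNIV"
      using u\<^sub>0 by auto
  qed
qed

section \<open>HNN-extensions and amalgamated products\<close>

text \<open>
  The stable letter acts as \<open>\<eta>\<close>, the inverse of \<open>\<theta>\<close>, so that the relation \<open>t^-1 x t = \<phi>(x)\<close> becomes the
  equivariance of \<open>\<theta>\<close>. The elements \<open>a\<close> and \<open>t b t^-1\<close> both commute with \<open>c\<close>, but not with each other.
\<close>

lemma not_CSA_HNN:
  fixes G :: "('a, 'm) monoid_scheme"
  assumes G: "group G"
    and A: "abelian_subgroup A G" "A \<noteq> {\<one>\<^bsub>G\<^esub>}" "\<not> maximal_abelian A G"
    and B: "abelian_subgroup B G" "\<not> maximal_abelian B G"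
    and \<phi>: "\<phi> \<in> iso (G\<lparr>carrier := A\<rparr>) (G\<lparr>carrier := B\<rparr>)"
  shows "\<not> CSA (HNN G A \<phi>)"
proof
  assume CSA: "CSA (HNN G A \<phi>)"
  interpret group G by (fact G)
  have subA: "subgroup A G" and subB: "subgroup B G"
    using A(1) B(1) by (auto simp: abelian_subgroup_def)
  have \<phi>B: "\<phi> x \<in> B" if "x \<in> A" for x
    using \<phi> that by (auto simp: iso_def dest: bij_betwE)
  obtain a where a: "a \<in> carrier G" "a \<notin> A" "\<And>x. x \<in> A \<Longrightarrow> a \<otimes>\<^bsub>G\<^esub> x = x \<otimes>\<^bsub>G\<^esub> a"
    using not_maximal_abelianE[OF A(1,3)] by blast
  obtain b where b: "b \<in> carrier G" "b \<notin> B" "\<And>x. x \<in> B \<Longrightarrow> b \<otimes>\<^bsub>G\<^esub> x = x \<otimes>\<^bsub>G\<^esub> b"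
    using not_maximal_abelianE[OF B] by blast
  obtain c where c: "c \<in> A" "c \<noteq> \<one>\<^bsub>G\<^esub>"
    using A(2) subgroup.one_closed[OF subA] by blast
  have car: "c \<in> carrier G" "\<phi> c \<in> carrier G"
    using c \<phi>B subgroup.mem_carrier[OF subA] subgroup.mem_carrier[OF subB] by auto
  define S where "S = Base ` carrier G \<union> {Stable}"
  define R where "R = mult_table Base G \<union>
      {([Inv Stable, Gen (Base x), Gen Stable], [Gen (Base (\<phi> x))]) | x. x \<in> A}"
  let ?a = "[Gen (Base a)]" and ?b = "[Gen Stable, Gen (Base b), Inv Stable]"
  let ?c = "[Gen (Base c)]"
  have inS: "Stable \<in> S" "Base ` carrier G \<subseteq> S" and inR: "mult_table Base G \<subseteq> R"
    by (auto simp: S_def R_def)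
  obtain \<theta> :: "'a \<times> ('a set + 'a set) list \<times> int \<Rightarrow> 'a \<times> ('a set + 'a set) list \<times> int" and \<eta> p
    where \<theta>: "\<And>p. p \<in> carrier G \<times> UNIV \<Longrightarrow> \<theta> p \<in> carrier G \<times> UNIV"
      and \<eta>: "\<And>q. q \<in> carrier G \<times> UNIV \<Longrightarrow> \<eta> q \<in> carrier G \<times> UNIV"
      and \<eta>\<theta>: "\<And>p. p \<in> carrier G \<times> UNIV \<Longrightarrow> \<eta> (\<theta> p) = p"
      and \<theta>\<eta>: "\<And>q. q \<in> carrier G \<times> UNIV \<Longrightarrow> \<theta> (\<eta> q) = q"
      and equiv: "\<And>x p. x \<in> A \<Longrightarrow> p \<in> carrier G \<times> UNIV \<Longrightarrow>
        \<theta> (translate G x p) = translate G (\<phi> x) (\<theta> p)"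
      and p: "p \<in> carrier G \<times> UNIV"
      and sep: "translate G a (\<eta> (translate G b (\<theta> p))) \<noteq> \<eta> (translate G b (\<theta> (translate G a p)))"
    by (rule noncommuting_equivariant_bij[OF G G subA subB \<phi> a(1,2) b(1,2)]) (rule that)
  define F where "F = case_hnn_gen (translate G) \<eta>"
  define F' where "F' = case_hnn_gen (\<lambda>g. translate G (inv\<^bsub>G\<^esub> g)) \<theta>"
  have model: "act F F' u p = act F F' v p"
    if "(u, v) \<in> word_cong S R" "p \<in> carrier G \<times> UNIV" for u v p
    using that
  proof (rule word_cong_act)
    show "F x p \<in> carrier G \<times> UNIV \<and> F' x p \<in> carrier G \<times> UNIV"
      if x: "x \<in> S" and p: "p \<in> carrier G \<times> UNIV" for x p
      using x translate_closed[OF _ p] \<theta>[OF p] \<eta>[OF p]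
      by (cases x) (simp_all add: S_def F_def F'_def image_iff)
    show "F' x (F x p) = p \<and> F x (F' x p) = p"
      if x: "x \<in> S" and p: "p \<in> carrier G \<times> UNIV" for x p
      using x translate_inverse[OF _ p] \<theta>\<eta>[OF p] \<eta>\<theta>[OF p]
      by (cases x) (simp_all add: S_def F_def F'_def image_iff)
    show "act F F' u p = act F F' v p"
      if uv: "(u, v) \<in> R" and p: "p \<in> carrier G \<times> UNIV" for u v p
    proof -
      consider x y where "x \<in> carrier G" "y \<in> carrier G"
          "u = [Gen (Base x), Gen (Base y)]" "v = [Gen (Base (x \<otimes>\<^bsub>G\<^esub> y))]"
        | x where "x \<in> A" "u = [Inv Stable, Gen (Base x), Gen Stable]" "v = [Gen (Base (\<phi> x))]"
        using uv by (auto simp: R_def mult_table_def)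
      then show ?thesis
        by cases (use p in \<open>simp_all add: F_def F'_def translate_mult equiv \<eta> \<theta>\<eta>\<close>)
    qed
  qed
  have "(?a @ ?b, ?b @ ?a) \<in> word_cong S R"
  proof (rule CSA_presented_group_commute)
    show "CSA (presented_group S R)"
      using CSA by (simp add: HNN_def S_def R_def)
    show "?a \<in> words S" "?b \<in> words S" "?c \<in> words S"
      using a b car by (auto simp: S_def)
    show "(?c, []) \<notin> word_cong S R"
      using model[of ?c "[]" p] translate_free[of c p] p c(2) car by (auto simp: F_def)
    show "(?a @ ?c, ?c @ ?a) \<in> word_cong S R"
      using word_cong_mult_table_commute[OF inR inS(2), of a c] a c car G by simp
    have "([Inv Stable, Gen (Base c), Gen Stable], [Gen (Base (\<phi> c))]) \<in> word_cong S R"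
      using c car by (intro word_cong.relation) (auto simp: R_def S_def)
    moreover have "([Gen (Base b), Gen (Base (\<phi> c))], [Gen (Base (\<phi> c)), Gen (Base b)]) \<in> word_cong S R"
      using word_cong_mult_table_commute[OF inR inS(2), of b "\<phi> c"] b c \<phi>B car G by simp
    ultimately show "(?b @ ?c, ?c @ ?b) \<in> word_cong S R"
      using word_cong_conjugate_commute[OF inS(1), of ?c "[Gen (Base (\<phi> c))]" R "[Gen (Base b)]"]
      by simp
  qed
  from model[OF this p] sep show False
    by (simp add: F_def F'_def)
qed

text \<open>
  The relation \<open>x = \<phi>(x)\<close> for \<open>x \<in> A\<close> becomes the equivariance of \<open>\<theta>\<close> once \<open>H\<close> acts on \<open>G \<times> N\<close> by
  transport along \<open>\<theta>\<close>. The elements \<open>a\<close> and \<open>b\<close> both commute with \<open>c\<close>, but not with each other.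
\<close>

lemma not_CSA_amalgamated_product:
  fixes G :: "('a, 'm) monoid_scheme" and H :: "('b, 'n) monoid_scheme"
  assumes G: "group G" and H: "group H"
    and A: "abelian_subgroup A G" "A \<noteq> {\<one>\<^bsub>G\<^esub>}" "\<not> maximal_abelian A G"
    and B: "abelian_subgroup B H" "\<not> maximal_abelian B H"
    and \<phi>: "\<phi> \<in> iso (G\<lparr>carrier := A\<rparr>) (H\<lparr>carrier := B\<rparr>)"
  shows "\<not> CSA (amalgamated_product G H A \<phi>)"
proof
  assume CSA: "CSA (amalgamated_product G H A \<phi>)"
  interpret G: group G by (fact G)
  interpret H: group H by (fact H)
  have subA: "subgroup A G" and subB: "subgroup B H"
    using A(1) B(1) by (auto simp: abelian_subgroup_def)
  have \<phi>B: "\<phi> x \<in> B" if "x \<in> A" for x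
    using \<phi> that by (auto simp: iso_def dest: bij_betwE)
  obtain a where a: "a \<in> carrier G" "a \<notin> A" "\<And>x. x \<in> A \<Longrightarrow> a \<otimes>\<^bsub>G\<^esub> x = x \<otimes>\<^bsub>G\<^esub> a"
    using not_maximal_abelianE[OF A(1,3)] by blast
  obtain b where b: "b \<in> carrier H" "b \<notin> B" "\<And>x. x \<in> B \<Longrightarrow> b \<otimes>\<^bsub>H\<^esub> x = x \<otimes>\<^bsub>H\<^esub> b"
    using not_maximal_abelianE[OF B] by blast
  obtain c where c: "c \<in> A" "c \<noteq> \<one>\<^bsub>G\<^esub>"
    using A(2) subgroup.one_closed[OF subA] by blast
  have car: "c \<in> carrier G" "\<phi> c \<in> carrier H"
    using c \<phi>B subgroup.mem_carrier[OF subA] subgroup.mem_carrier[OF subB] by auto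
  define S where "S = Inl ` carrier G \<union> Inr ` carrier H"
  define R where "R = mult_table Inl G \<union> mult_table Inr H \<union>
      {([Gen (Inl x)], [Gen (Inr (\<phi> x))]) | x. x \<in> A}"
  let ?a = "[Gen (Inl a)]" and ?b = "[Gen (Inr b)]" and ?c = "[Gen (Inl c)]"
  have words: "?a \<in> words S" "?b \<in> words S" "?c \<in> words S" "[Gen (Inr (\<phi> c))] \<in> words S"
    using a b car by (auto simp: S_def)
  have inS: "Inl ` carrier G \<subseteq> S" "Inr ` carrier H \<subseteq> S"
    and inR: "mult_table Inl G \<subseteq> R" "mult_table Inr H \<subseteq> R"
    by (auto simp: S_def R_def)
  obtain \<theta> :: "'a \<times> ('a set + 'b set) list \<times> int \<Rightarrow> 'b \<times> ('a set + 'b set) list \<times> int" and \<eta> p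
    where \<theta>: "\<And>p. p \<in> carrier G \<times> UNIV \<Longrightarrow> \<theta> p \<in> carrier H \<times> UNIV"
      and \<eta>: "\<And>q. q \<in> carrier H \<times> UNIV \<Longrightarrow> \<eta> q \<in> carrier G \<times> UNIV"
      and \<eta>\<theta>: "\<And>p. p \<in> carrier G \<times> UNIV \<Longrightarrow> \<eta> (\<theta> p) = p"
      and \<theta>\<eta>: "\<And>q. q \<in> carrier H \<times> UNIV \<Longrightarrow> \<theta> (\<eta> q) = q"
      and equiv: "\<And>x p. x \<in> A \<Longrightarrow> p \<in> carrier G \<times> UNIV \<Longrightarrow>
        \<theta> (translate G x p) = translate H (\<phi> x) (\<theta> p)"
      and p: "p \<in> carrier G \<times> UNIV"
      and sep: "translate G a (\<eta> (translate H b (\<theta> p))) \<noteq> \<eta> (translate H b (\<theta> (translate G a p)))"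
    by (rule noncommuting_equivariant_bij[OF G H subA subB \<phi> a(1,2) b(1,2)]) (rule that)
  define F where "F = case_sum (translate G) (\<lambda>h p. \<eta> (translate H h (\<theta> p)))"
  define F' where "F' = case_sum (\<lambda>g. translate G (inv\<^bsub>G\<^esub> g))
      (\<lambda>h p. \<eta> (translate H (inv\<^bsub>H\<^esub> h) (\<theta> p)))"
  have model: "act F F' u p = act F F' v p"
    if "(u, v) \<in> word_cong S R" "p \<in> carrier G \<times> UNIV" for u v p
    using that
  proof (rule word_cong_act)
    show "F x p \<in> carrier G \<times> UNIV \<and> F' x p \<in> carrier G \<times> UNIV"
      if x: "x \<in> S" and p: "p \<in> carrier G \<times> UNIV" for x p
    proof (cases x)
      case (Inl g)
      then show ?thesis
        using x p G.translate_closed[OF _ p] by (auto simp: S_def F_def F'_def)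
    next
      case (Inr h)
      then have h: "h \<in> carrier H"
        using x by (auto simp: S_def)
      show ?thesis
        using \<eta>[OF H.translate_closed[OF h \<theta>[OF p]]]
          \<eta>[OF H.translate_closed[OF H.inv_closed[OF h] \<theta>[OF p]]] Inr
        by (simp add: F_def F'_def)
    qed
    show "F' x (F x p) = p \<and> F x (F' x p) = p"
      if x: "x \<in> S" and p: "p \<in> carrier G \<times> UNIV" for x p
    proof (cases x)
      case (Inl g)
      then show ?thesis
        using x p G.translate_inverse[OF _ p] by (auto simp: S_def F_def F'_def)
    next
      case (Inr h)
      then have h: "h \<in> carrier H"
        using x by (auto simp: S_def)
      show ?thesis
        using H.translate_inverse[OF h \<theta>[OF p]] H.translate_closed[OF h \<theta>[OF p]]
          H.translate_closed[OF H.inv_closed[OF h] \<theta>[OF p]] Inr p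
        by (simp add: F_def F'_def \<theta>\<eta> \<eta>\<theta>)
    qed
    show "act F F' u p = act F F' v p"
      if uv: "(u, v) \<in> R" and p: "p \<in> carrier G \<times> UNIV" for u v p
    proof -
      consider x y where "x \<in> carrier G" "y \<in> carrier G"
          "u = [Gen (Inl x), Gen (Inl y)]" "v = [Gen (Inl (x \<otimes>\<^bsub>G\<^esub> y))]"
        | x y where "x \<in> carrier H" "y \<in> carrier H"
          "u = [Gen (Inr x), Gen (Inr y)]" "v = [Gen (Inr (x \<otimes>\<^bsub>H\<^esub> y))]"
        | x where "x \<in> A" "u = [Gen (Inl x)]" "v = [Gen (Inr (\<phi> x))]"
        using uv by (auto simp: R_def mult_table_def)
      then show ?thesis
      proof cases
        case 1
        then show ?thesis
          using p by (simp add: F_def G.translate_mult)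
      next
        case 2
        then show ?thesis
          using H.translate_mult[OF _ _ \<theta>[OF p]] H.translate_closed[OF _ \<theta>[OF p]]
          by (simp add: F_def \<theta>\<eta>)
      next
        case 3
        then have "translate G x p \<in> carrier G \<times> UNIV"
          using G.translate_closed[OF _ p] subgroup.mem_carrier[OF subA] by blast
        then show ?thesis
          using 3 p by (simp add: F_def equiv[symmetric] \<eta>\<theta>)
      qed
    qed
  qed
  have "(?a @ ?b, ?b @ ?a) \<in> word_cong S R"
  proof (rule CSA_presented_group_commute)
    show "CSA (presented_group S R)"
      using CSA by (simp add: amalgamated_product_def S_def R_def)
    show "(?c, []) \<notin> word_cong S R"
      using model[of ?c "[]" p] G.translate_free[of c p] p c(2) car by (auto simp: F_def)
    show "(?a @ ?c, ?c @ ?a) \<in> word_cong S R"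
      using word_cong_mult_table_commute[OF inR(1) inS(1), of a c] a c car G by simp
    have rel: "(?c, [Gen (Inr (\<phi> c))]) \<in> word_cong S R"
      using words c by (intro word_cong.relation) (auto simp: R_def)
    have comm: "(?b @ [Gen (Inr (\<phi> c))], [Gen (Inr (\<phi> c))] @ ?b) \<in> word_cong S R"
      using word_cong_mult_table_commute[OF inR(2) inS(2), of b "\<phi> c"] b c \<phi>B car H by simp
    show "(?b @ ?c, ?c @ ?b) \<in> word_cong S R"
      using word_cong.trans[OF word_cong.trans[OF
          word_cong.append[OF word_cong.refl[OF words(2)] rel] comm]
          word_cong.append[OF word_cong.sym[OF rel] word_cong.refl[OF words(2)]]]
      by simp
  qed (use words in simp_all)
  from model[OF this p] sep show False
    by (simp add: F_def)
qed

theorem proposition3: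
  shows "(\<forall>(G :: ('a, 'm) monoid_scheme) A B \<phi>.
            group G \<and>
            abelian_subgroup A G \<and> A \<noteq> {\<one>\<^bsub>G\<^esub>} \<and>
            abelian_subgroup B G \<and> B \<noteq> {\<one>\<^bsub>G\<^esub>} \<and>
            \<phi> \<in> iso (G\<lparr>carrier := A\<rparr>) (G\<lparr>carrier := B\<rparr>) \<and>
            \<not> maximal_abelian A G \<and> \<not> maximal_abelian B G
            \<longrightarrow> \<not> CSA (HNN G A \<phi>)) \<and>
         (\<forall>(G :: ('b, 'n) monoid_scheme) (H :: ('c, 'k) monoid_scheme) A B \<phi>.
            group G \<and> group H \<and>
            abelian_subgroup A G \<and> A \<noteq> {\<one>\<^bsub>G\<^esub>} \<and>
            abelian_subgroup B H \<and> B \<noteq> {\<one>\<^bsub>H\<^esub>} \<and>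
            \<phi> \<in> iso (G\<lparr>carrier := A\<rparr>) (H\<lparr>carrier := B\<rparr>) \<and>
            \<not> maximal_abelian A G \<and> \<not> maximal_abelian B H
            \<longrightarrow> \<not> CSA (amalgamated_product G H A \<phi>))"
  using not_CSA_HNN not_CSA_amalgamated_product by blast

end
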